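(* Let $G=(A\cup B,E)$ with $|A|=|B|=n$ admit a perfect matching, and let $M$ be a perfect matching in $G$. Then $M$ is a popular assignment if and only if there exists an optimal solution $\vec\alpha$ to the linear program (LP2) $\min \sum_{u\in A\cup B} y_u$ subject to $y_a+y_b\ge \mathsf{wt}_M(a,b)$ for all $(a,b)\in E$, such that $\alpha_a\in\{0,1,\dots,n-1\}$ for all $a\in A$, $\alpha_b\in\{0,-1,\dots,-(n-1)\}$ for all $b\in B$, and $\sum_{u\in A\cup B}\alpha_u=0$.
   Context: Every agent $a\in A$ has a strict partial order $\succ_a$ over her neighbors in $B$; objects have no preferences. For a perfect matching $M$ and $(a,b)\in E$: $\mathsf{wt}_M(a,b)=1$ if $b\succ_a M(a)$, $\mathsf{wt}_M(a,b)=-1$ if $M(a)\succ_a b$, and $0$ otherwise. For matchings $M,N$, agent $a$ prefers $M$ to $N$ if $a$ is matched in $M$ and either unmatched in $N$ or $M(a)\succ_a N(a)$; $\phi(M,N)$ counts agents preferring $M$ to $N$ and $\Delta(M,N)=\phi(M,N)-\phi(N,M)$. A popular assignment is a perfect matching $M$ with $\Delta(M,N)\ge 0$ for all perfect matchings $N$. *)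

theory Defs
  imports Complex_Main
begin

text \<open>
  Vertices share one type \<open>'v\<close>. An edge between agent \<open>a \<in> A\<close> and object \<open>b \<in> B\<close> is the
  ordered pair \<open>(a, b)\<close>, so \<open>E \<subseteq> A \<times> B\<close>, and \<open>pref a b c\<close> reads ``\<open>a\<close> strictly prefers
  \<open>b\<close> to \<open>c\<close>''.
\<close>

definition bipartite_graph :: "'v set \<Rightarrow> 'v set \<Rightarrow> ('v \<times> 'v) set \<Rightarrow> bool" where
  "bipartite_graph A B E \<longleftrightarrow> finite A \<and> finite B \<and> A \<inter> B = {} \<and> E \<subseteq> A \<times> B"

definition neighbors :: "('v \<times> 'v) set \<Rightarrow> 'v \<Rightarrow> 'v set" where
  "neighbors E a = {b. (a, b) \<in> E}"

definition strict_partial_order_on :: "'v set \<Rightarrow> ('v \<Rightarrow> 'v \<Rightarrow> bool) \<Rightarrow> bool" where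
  "strict_partial_order_on S r \<longleftrightarrow> irreflp_on S r \<and> transp_on S r"

definition matching :: "('v \<times> 'v) set \<Rightarrow> ('v \<times> 'v) set \<Rightarrow> bool" where
  "matching E M \<longleftrightarrow> M \<subseteq> E \<and>
     (\<forall>a b a' b'. (a, b) \<in> M \<and> (a', b') \<in> M \<longrightarrow> (a = a' \<longleftrightarrow> b = b'))"

definition perfect_matching ::
    "'v set \<Rightarrow> 'v set \<Rightarrow> ('v \<times> 'v) set \<Rightarrow> ('v \<times> 'v) set \<Rightarrow> bool" where
  "perfect_matching A B E M \<longleftrightarrow>
     matching E M \<and> (\<forall>a\<in>A. \<exists>b. (a, b) \<in> M) \<and> (\<forall>b\<in>B. \<exists>a. (a, b) \<in> M)"

definition agent_matched :: "('v \<times> 'v) set \<Rightarrow> 'v \<Rightarrow> bool" where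
  "agent_matched M a \<longleftrightarrow> (\<exists>b. (a, b) \<in> M)"

text \<open>The object \<open>M(a)\<close>; meaningful only if \<open>a\<close> is matched in the matching \<open>M\<close>.\<close>

definition partner :: "('v \<times> 'v) set \<Rightarrow> 'v \<Rightarrow> 'v" where
  "partner M a = (THE b. (a, b) \<in> M)"

definition prefers_matching ::
    "('v \<Rightarrow> 'v \<Rightarrow> 'v \<Rightarrow> bool) \<Rightarrow> 'v \<Rightarrow> ('v \<times> 'v) set \<Rightarrow> ('v \<times> 'v) set \<Rightarrow> bool" where
  "prefers_matching pref a M N \<longleftrightarrow>
     agent_matched M a \<and> (\<not> agent_matched N a \<or> pref a (partner M a) (partner N a))"

definition votes ::
    "'v set \<Rightarrow> ('v \<Rightarrow> 'v \<Rightarrow> 'v \<Rightarrow> bool) \<Rightarrow> ('v \<times> 'v) set \<Rightarrow> ('v \<times> 'v) set \<Rightarrow> nat" where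
  "votes A pref M N = card {a \<in> A. prefers_matching pref a M N}"

definition vote_diff ::
    "'v set \<Rightarrow> ('v \<Rightarrow> 'v \<Rightarrow> 'v \<Rightarrow> bool) \<Rightarrow> ('v \<times> 'v) set \<Rightarrow> ('v \<times> 'v) set \<Rightarrow> int" where
  "vote_diff A pref M N = int (votes A pref M N) - int (votes A pref N M)"

definition popular_assignment ::
    "'v set \<Rightarrow> 'v set \<Rightarrow> ('v \<times> 'v) set \<Rightarrow> ('v \<Rightarrow> 'v \<Rightarrow> 'v \<Rightarrow> bool) \<Rightarrow> ('v \<times> 'v) set \<Rightarrow> bool" where
  "popular_assignment A B E pref M \<longleftrightarrow>
     perfect_matching A B E M \<and>
     (\<forall>N. perfect_matching A B E N \<longrightarrow> vote_diff A pref M N \<ge> 0)"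

definition wt :: "('v \<Rightarrow> 'v \<Rightarrow> 'v \<Rightarrow> bool) \<Rightarrow> ('v \<times> 'v) set \<Rightarrow> 'v \<Rightarrow> 'v \<Rightarrow> real" where
  "wt pref M a b =
     (if pref a b (partner M a) then 1 else if pref a (partner M a) b then -1 else 0)"

definition LP2_feasible ::
    "('v \<times> 'v) set \<Rightarrow> ('v \<Rightarrow> 'v \<Rightarrow> 'v \<Rightarrow> bool) \<Rightarrow> ('v \<times> 'v) set \<Rightarrow> ('v \<Rightarrow> real) \<Rightarrow> bool" where
  "LP2_feasible E pref M y \<longleftrightarrow> (\<forall>(a, b)\<in>E. y a + y b \<ge> wt pref M a b)"

definition LP2_optimal ::
    "'v set \<Rightarrow> 'v set \<Rightarrow> ('v \<times> 'v) set \<Rightarrow> ('v \<Rightarrow> 'v \<Rightarrow> 'v \<Rightarrow> bool) \<Rightarrow> ('v \<times> 'v) set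
      \<Rightarrow> ('v \<Rightarrow> real) \<Rightarrow> bool" where
  "LP2_optimal A B E pref M y \<longleftrightarrow>
     LP2_feasible E pref M y \<and>
     (\<forall>z. LP2_feasible E pref M z \<longrightarrow> (\<Sum>u\<in>A \<union> B. y u) \<le> (\<Sum>u\<in>A \<union> B. z u))"

end

theory Submission
  imports Defs "HOL-Combinatorics.Cycles"
begin

text \<open>
  Identify each object with the agent that \<open>M\<close> assigns to it. Perfect matchings become
  permutations of \<open>A\<close>, and \<open>\<Delta>(M,N)\<close> is minus the \<open>wt\<^sub>M\<close>-weight of the permutation of \<open>N\<close>; so
  \<open>M\<close> is popular iff the digraph on \<open>A\<close> with weights \<open>wt\<^sub>M\<close> has no cycle of positive weight. In that
  case let \<open>\<alpha> a\<close> be the maximum weight of a simple path starting at \<open>a\<close>, which lies between \<open>0\<close>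
  and \<open>n - 1\<close>, and put \<open>\<alpha> (M a) = - \<alpha> a\<close>. Conversely, summing the constraints of (LP2) over the
  edges of a perfect matching \<open>N\<close> bounds \<open>- \<Delta>(M,N)\<close> by the objective value.
\<close>

section \<open>Potentials in digraphs without positive cycles\<close>

definition path_weight :: "('a \<Rightarrow> 'a \<Rightarrow> 'b::comm_monoid_add) \<Rightarrow> 'a list \<Rightarrow> 'b" where
  "path_weight w xs = sum_list (map2 w xs (tl xs))"

lemma path_weight_simps [simp]:
  "path_weight w [] = 0"
  "path_weight w [x] = 0"
  "path_weight w (x # y # zs) = w x y + path_weight w (y # zs)"
  by (simp_all add: path_weight_def)

text \<open>The split vertex \<open>a\<close> belongs to both pieces, so every edge is counted
  exactly once. This is what lets a closed walk be cut off the front of a path.\<close>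

lemma path_weight_append:
  "path_weight w (us @ a # vs) = path_weight w (us @ [a]) + path_weight w (a # vs)"
proof (induction us)
  case (Cons u us)
  then show ?case by (cases us) (simp_all add: add.assoc)
qed simp

text \<open>A path on k vertices has k - 1 edges, each of weight at most 1. This is the source of
  the bound n - 1 on the dual values.\<close>

lemma path_weight_le_length:
  fixes w :: "'a \<Rightarrow> 'a \<Rightarrow> int"
  assumes "\<And>x y. w x y \<le> 1" "xs \<noteq> []"
  shows "path_weight w xs \<le> int (length xs) - 1"
  using assms(2)
proof (induction xs rule: induct_list012)
  case (3 x y zs)
  then show ?case using assms(1)[of x y] by simp
qed simp_all

text \<open>The hypothesis \<open>perm\<close> speaks only of permutations of all of
  \<open>A\<close>. A single cycle is completed to one by fixing every other vertex, which is
  admissible because loops satisfy \<open>R\<close> and costs nothing because they have weight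
  0.\<close>

lemma cycle_weight_le_0:
  fixes w :: "'a \<Rightarrow> 'a \<Rightarrow> 'b::ordered_comm_monoid_add"
  assumes "finite A"
    and perm: "\<And>\<sigma>. \<sigma> permutes A \<Longrightarrow> (\<And>a. a \<in> A \<Longrightarrow> R a (\<sigma> a)) \<Longrightarrow> (\<Sum>a\<in>A. w a (\<sigma> a)) \<le> 0"
    and loop: "\<And>a. a \<in> A \<Longrightarrow> R a a" "\<And>a. a \<in> A \<Longrightarrow> w a a = 0"
    and "distinct (a # us)" "set (a # us) \<subseteq> A" "successively R (a # us @ [a])"
  shows "path_weight w (a # us @ [a]) \<le> 0"
proof -
  let ?c = "a # us" and ?\<sigma> = "cycle_of_list (a # us)"
  have perm_c: "?\<sigma> permutes set ?c"
    by (rule cycle_permutes)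
  \<comment> \<open>One application of the cyclic permutation rotates the list of the cycle, so each
    entry is sent to its successor and the last one to \<open>a\<close>.\<close>
  have "map (?\<sigma> ^^ 1) ?c = rotate 1 ?c"
    by (rule cyclic_rotation) (fact assms)
  then have map_c: "map ?\<sigma> ?c = us @ [a]"
    by simp
  have fix_c: "?\<sigma> x = x" if "x \<notin> set ?c" for x
    using perm_c that by (rule permutes_not_in)
  have R: "R x (?\<sigma> x)" if "x \<in> A" for x
  proof (cases "x \<in> set ?c")
    case True
    then obtain i where i: "i < length ?c" "x = ?c ! i"
      by (metis in_set_conv_nth)
    have "?\<sigma> x = (us @ [a]) ! i"
      using i map_c by (metis nth_map)
    moreover have "R ((a # us @ [a]) ! i) ((a # us @ [a]) ! Suc i)"
      using assms(7) i by (simp only: successively_conv_nth) simp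
    moreover have "(a # us @ [a]) ! i = x"
      using i by (metis append_Cons nth_append)
    ultimately show ?thesis
      by simp
  next
    case False
    then show ?thesis
      using fix_c loop(1) that by metis
  qed
  \<comment> \<open>\<open>zip\<close> stops at the shorter list, so the closing \<open>a\<close> is
    dropped on the left and the consecutive pairs of the closed walk are the pairs of a vertex and
    its image.\<close>
  have "zip (a # us @ [a]) (us @ [a]) = zip ?c (map ?\<sigma> ?c)"
    using zip_append1[of ?c "[a]" "us @ [a]"] unfolding map_c by simp
  then have "path_weight w (a # us @ [a]) = sum_list (map2 w ?c (map ?\<sigma> ?c))"
    by (simp only: path_weight_def list.sel)
  also have "\<dots> = sum_list (map (\<lambda>x. w x (?\<sigma> x)) ?c)"
    by (simp only: zip_map2 zip_same_conv_map map_map comp_def prod.case)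
  also have "\<dots> = (\<Sum>x\<in>set ?c. w x (?\<sigma> x))"
    using assms(5) by (rule sum_list_distinct_conv_sum_set)
  also have "\<dots> = (\<Sum>x\<in>A. w x (?\<sigma> x))"
    using assms(1,6) fix_c loop(2) by (intro sum.mono_neutral_left) auto
  also have "\<dots> \<le> 0"
    using permutes_subset[OF perm_c assms(6)] R by (rule perm)
  finally show ?thesis .
qed

text \<open>Maximizing over simple paths only keeps the set of candidates finite and their lengths
  at most \<open>card A\<close>. The price is that prepending \<open>a\<close> to a best path from
  \<open>b\<close> may visit \<open>a\<close> twice; the cycle that arises then has weight at most 0
  and can be cut off.\<close>

lemma ex_bounded_potential:
  fixes w :: "'a \<Rightarrow> 'a \<Rightarrow> int"
  assumes "finite A"
    and perm: "\<And>\<sigma>. \<sigma> permutes A \<Longrightarrow> (\<And>a. a \<in> A \<Longrightarrow> R a (\<sigma> a)) \<Longrightarrow> (\<Sum>a\<in>A. w a (\<sigma> a)) \<le> 0"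
    and loop: "\<And>a. a \<in> A \<Longrightarrow> R a a" "\<And>a. a \<in> A \<Longrightarrow> w a a = 0"
    and le_1: "\<And>x y. w x y \<le> 1"
  obtains p :: "'a \<Rightarrow> int"
  where "\<And>a. a \<in> A \<Longrightarrow> p a \<in> {0..int (card A) - 1}"
    and "\<And>a b. a \<in> A \<Longrightarrow> b \<in> A \<Longrightarrow> R a b \<Longrightarrow> w a b + p b \<le> p a"
proof
  define P where
    "P a = {xs. xs \<noteq> [] \<and> hd xs = a \<and> distinct xs \<and> set xs \<subseteq> A \<and> successively R xs}" for a
  define p where "p a = Max (path_weight w ` P a)" for a
  have fin: "finite (path_weight w ` P a)" for a
    using finite_subset_distinct[OF \<open>finite A\<close>] by (rule finite_imageI[OF finite_subset, rotated]) (auto simp: P_def)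
  have single: "[a] \<in> P a" if "a \<in> A" for a
    using that by (simp add: P_def)
  have ge: "path_weight w xs \<le> p a" if "xs \<in> P a" for xs a
    unfolding p_def using fin that by simp
  have attained: "\<exists>xs\<in>P a. p a = path_weight w xs" if "a \<in> A" for a
    using Max_in[OF fin, of a] single[OF that] unfolding p_def by blast
  show "p a \<in> {0..int (card A) - 1}" if "a \<in> A" for a
  proof -
    obtain xs where xs: "xs \<in> P a" "p a = path_weight w xs"
      using attained \<open>a \<in> A\<close> by blast
    have "length xs \<le> card A"
      using xs(1) card_mono[OF \<open>finite A\<close>, of "set xs"] by (simp add: P_def distinct_card)
    then have "p a \<le> int (card A) - 1"
      using path_weight_le_length[of w, OF le_1, of xs] xs by (simp add: P_def)
    \<comment> \<open>The one-vertex path has weight 0.\<close>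
    moreover have "0 \<le> p a"
      using ge[OF single[OF that]] by simp
    ultimately show ?thesis
      by simp
  qed
  show "w a b + p b \<le> p a" if "a \<in> A" "b \<in> A" "R a b" for a b
  proof -
    obtain ys where ys: "ys \<in> P b" "p b = path_weight w ys"
      using attained[OF \<open>b \<in> A\<close>] by blast
    then have hd: "path_weight w (a # ys) = w a b + p b" "successively R (a # ys)"
      using \<open>R a b\<close> by (cases ys; simp add: P_def)+
    show ?thesis
    proof (cases "a \<in> set ys")
      case False
      then have "a # ys \<in> P a"
        using ys(1) hd(2) \<open>a \<in> A\<close> by (simp add: P_def)
      then show ?thesis
        using ge hd(1) by metis
    next
      \<comment> \<open>Here \<open>a # ys\<close> is the closed walk \<open>a # us @ [a]\<close>
        followed by the simple path \<open>a # vs\<close>. The first part weighs at most 0, the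
        second at most \<open>p a\<close>.\<close>
      case True
      then obtain us vs where uv: "ys = us @ a # vs"
        by (meson split_list)
      have "successively R (a # us @ [a])" "successively R (a # vs)"
        using hd(2) successively_append_iff[of R "a # us" "a # vs"]
          successively_append_iff[of R "a # us" "[a]"] by (auto simp: uv)
      moreover have "distinct (a # us)" "set (a # us) \<subseteq> A" "distinct (a # vs)" "set (a # vs) \<subseteq> A"
        using ys(1) by (auto simp: P_def uv)
      ultimately have "path_weight w (a # us @ [a]) \<le> 0" "a # vs \<in> P a"
        using cycle_weight_le_0[of A R w, OF \<open>finite A\<close> perm loop] by (blast, simp add: P_def)
      then show ?thesis
        using ge[of "a # vs" a] hd(1) path_weight_append[of w "a # us" a vs] by (simp add: uv)
    qed
  qed
qed

section \<open>Perfect matchings\<close>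

lemma partner_eq: "matching E M \<Longrightarrow> (a, b) \<in> M \<Longrightarrow> partner M a = b"
  unfolding partner_def matching_def by (rule the_equality) blast+

lemma perfect_matching_partner:
  assumes "perfect_matching A B E M" "a \<in> A"
  shows "(a, partner M a) \<in> M" "(a, partner M a) \<in> E"
proof -
  show "(a, partner M a) \<in> M"
    using assms partner_eq unfolding perfect_matching_def by metis
  then show "(a, partner M a) \<in> E"
    using assms unfolding perfect_matching_def matching_def by blast
qed

lemma bij_betw_partner:
  assumes "bipartite_graph A B E" "perfect_matching A B E M"
  shows "bij_betw (partner M) A B"
proof (rule bij_betw_imageI)
  have M: "matching E M" "E \<subseteq> A \<times> B" "M \<subseteq> E"
    using assms by (auto simp: perfect_matching_def bipartite_graph_def matching_def)
  show "inj_on (partner M) A"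
  proof (rule inj_onI)
    fix x y assume "x \<in> A" "y \<in> A" "partner M x = partner M y"
    then have "(x, partner M x) \<in> M" "(y, partner M x) \<in> M"
      using perfect_matching_partner(1)[OF assms(2)] by metis+
    then show "x = y"
      using M(1) unfolding matching_def by blast
  qed
  show "partner M ` A = B"
  proof
    show "partner M ` A \<subseteq> B"
      using perfect_matching_partner(2)[OF assms(2)] M(2) by blast
    show "B \<subseteq> partner M ` A"
    proof
      fix b assume "b \<in> B"
      then obtain a where "(a, b) \<in> M"
        using assms(2) unfolding perfect_matching_def by blast
      then show "b \<in> partner M ` A"
        using partner_eq[OF M(1)] M(2,3) by blast
    qed
  qed
qed

lemma perfect_matching_of_bij:
  assumes "bij_betw f A B" "\<And>a. a \<in> A \<Longrightarrow> (a, f a) \<in> E"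
  shows "perfect_matching A B E ((\<lambda>a. (a, f a)) ` A)"
  using assms unfolding perfect_matching_def matching_def bij_betw_def
  by (auto dest: inj_onD)

section \<open>Dual objective and vote difference as sums over the agents\<close>

lemma sum_bipartite_eq:
  fixes y :: "'v \<Rightarrow> 'b::comm_monoid_add"
  assumes "bipartite_graph A B E" "perfect_matching A B E N"
  shows "(\<Sum>u\<in>A \<union> B. y u) = (\<Sum>a\<in>A. y a + y (partner N a))"
proof -
  have "(\<Sum>u\<in>A \<union> B. y u) = (\<Sum>a\<in>A. y a) + (\<Sum>b\<in>B. y b)"
    using assms(1) unfolding bipartite_graph_def by (intro sum.union_disjoint) auto
  also have "(\<Sum>b\<in>B. y b) = (\<Sum>a\<in>A. y (partner N a))"
    using sum.reindex_bij_betw[OF bij_betw_partner[OF assms]] by metis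
  finally show ?thesis
    by (simp add: sum.distrib)
qed

text \<open>The edges of \<open>N\<close> meet every vertex exactly once, so their constraints add
  up to the objective. Taking \<open>N\<close> to be \<open>M\<close> later shows that 0 is a lower
  bound for the objective; arbitrary \<open>N\<close> yields popularity.\<close>

lemma LP2_weak_duality:
  assumes "bipartite_graph A B E" "perfect_matching A B E N" "LP2_feasible E pref M y"
  shows "(\<Sum>a\<in>A. wt pref M a (partner N a)) \<le> (\<Sum>u\<in>A \<union> B. y u)"
  unfolding sum_bipartite_eq[OF assms(1,2)]
  using assms(3) perfect_matching_partner(2)[OF assms(2)]
  by (intro sum_mono) (auto simp: LP2_feasible_def)

lemma vote_diff_eq:
  assumes "finite A" "perfect_matching A B E M" "perfect_matching A B E N"
    and "\<And>a. a \<in> A \<Longrightarrow> strict_partial_order_on (neighbors E a) (pref a)"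
  shows "real_of_int (vote_diff A pref M N) = - (\<Sum>a\<in>A. wt pref M a (partner N a))"
proof -
  have prefers: "prefers_matching pref a M' N' \<longleftrightarrow> pref a (partner M' a) (partner N' a)"
    if "perfect_matching A B E M'" "perfect_matching A B E N'" "a \<in> A" for M' N' a
    using that unfolding prefers_matching_def agent_matched_def perfect_matching_def by blast
  \<comment> \<open>If both comparisons held, the two votes would cancel while \<open>wt\<close>,
    which tests one of them first, would give 1. Irreflexivity and transitivity rule this
    out.\<close>
  have asym: "\<not> (pref a x y \<and> pref a y x)" if "a \<in> A" "(a, x) \<in> E" "(a, y) \<in> E" for a x y
    using assms(4)[OF that(1)] that
    unfolding strict_partial_order_on_def neighbors_def irreflp_on_def transp_on_def by blast
  have count: "real (votes A pref M' N') = (\<Sum>a\<in>A. of_bool (pref a (partner M' a) (partner N' a)))"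
    if "perfect_matching A B E M'" "perfect_matching A B E N'" for M' N'
  proof -
    have "{a \<in> A. prefers_matching pref a M' N'} = A \<inter> {a. pref a (partner M' a) (partner N' a)}"
      using prefers[OF that] by blast
    then show ?thesis
      using assms(1) by (simp add: votes_def sum.If_cases of_bool_def)
  qed
  have "real_of_int (vote_diff A pref M N) = (\<Sum>a\<in>A. of_bool (pref a (partner M a) (partner N a))
      - of_bool (pref a (partner N a) (partner M a)))"
    unfolding vote_diff_def using count assms(2,3) by (simp add: sum_subtractf)
  also have "\<dots> = (\<Sum>a\<in>A. - wt pref M a (partner N a))"
    using asym[OF _ perfect_matching_partner(2)[OF assms(2)] perfect_matching_partner(2)[OF assms(3)]]
    by (intro sum.cong refl) (auto simp: wt_def of_bool_def)
  finally show ?thesis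
    by (simp add: sum_negf)
qed

theorem theorem7:
  fixes A B :: "'v set" and E M :: "('v \<times> 'v) set"
    and pref :: "'v \<Rightarrow> 'v \<Rightarrow> 'v \<Rightarrow> bool" and n :: nat
  assumes "bipartite_graph A B E"
    and "card A = n" and "card B = n"
    and "\<And>a. a \<in> A \<Longrightarrow> strict_partial_order_on (neighbors E a) (pref a)"
    and "perfect_matching A B E M"
  shows "popular_assignment A B E pref M \<longleftrightarrow>
    (\<exists>\<alpha> :: 'v \<Rightarrow> real.
       LP2_optimal A B E pref M \<alpha> \<and>
       (\<forall>a\<in>A. \<alpha> a \<in> real_of_int ` {0..int n - 1}) \<and>
       (\<forall>b\<in>B. \<alpha> b \<in> real_of_int ` {- (int n - 1)..0}) \<and>
       (\<Sum>u\<in>A \<union> B. \<alpha> u) = 0)"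
proof -
  let ?m = "partner M" and ?w = "wt pref M"
  note bip = \<open>bipartite_graph A B E\<close> and PM = \<open>perfect_matching A B E M\<close>
  have fin: "finite A" and disj: "A \<inter> B = {}" and EAB: "E \<subseteq> A \<times> B"
    using bip by (auto simp: bipartite_graph_def)
  have bij: "bij_betw ?m A B"
    using bip PM by (rule bij_betw_partner)
  have mE: "(a, ?m a) \<in> E" if "a \<in> A" for a
    using PM that by (rule perfect_matching_partner)
  have diff: "real_of_int (vote_diff A pref M N) = - (\<Sum>a\<in>A. ?w a (partner N a))"
    if "perfect_matching A B E N" for N
    using fin PM that assms(4) by (rule vote_diff_eq)
  have loop: "?w a (?m a) = 0" if "a \<in> A" for a
    using assms(4)[OF that] mE[OF that]
    by (auto simp: wt_def strict_partial_order_on_def neighbors_def irreflp_on_def)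
  show ?thesis
  proof
    assume pop: "popular_assignment A B E pref M"
    \<comment> \<open>The second argument is now the agent that owns the object in \<open>M\<close>.
      The values of \<open>wt\<close> are -1, 0 and 1, so the floor loses nothing and makes the
      potential integral.\<close>
    define w where "w a a' = \<lfloor>?w a (?m a')\<rfloor>" for a a'
    have w: "?w a (?m a') = of_int (w a a')" for a a'
      by (simp add: w_def wt_def)
    \<comment> \<open>A permutation \<sigma> along edges encodes the perfect matching that gives
      each agent \<open>a\<close> the object owned by \<sigma>(a) in \<open>M\<close>; popularity
      against it bounds the weight.\<close>
    have cyc: "(\<Sum>a\<in>A. w a (\<sigma> a)) \<le> 0"
      if "\<sigma> permutes A" and edge: "\<And>a. a \<in> A \<Longrightarrow> (a, ?m (\<sigma> a)) \<in> E" for \<sigma>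
    proof -
      let ?N = "(\<lambda>a. (a, ?m (\<sigma> a))) ` A"
      have "bij_betw (?m \<circ> \<sigma>) A B"
        using permutes_imp_bij[OF that(1)] bij by (rule bij_betw_trans)
      then have N: "perfect_matching A B E ?N"
        using perfect_matching_of_bij[of "?m \<circ> \<sigma>"] edge by simp
      have "partner ?N a = ?m (\<sigma> a)" if "a \<in> A" for a
        using N that by (intro partner_eq[of E]) (auto simp: perfect_matching_def)
      then have "real_of_int (\<Sum>a\<in>A. w a (\<sigma> a)) = (\<Sum>a\<in>A. ?w a (partner ?N a))"
        by (simp add: w)
      also have "\<dots> = - real_of_int (vote_diff A pref M ?N)"
        using diff[OF N] by simp
      also have "\<dots> \<le> 0"
        using pop N by (simp add: popular_assignment_def)
      finally show ?thesis
        by (simp only: of_int_le_0_iff)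
    qed
    obtain p where p: "\<And>a. a \<in> A \<Longrightarrow> p a \<in> {0..int (card A) - 1}"
      and step: "\<And>a b. a \<in> A \<Longrightarrow> b \<in> A \<Longrightarrow> (a, ?m b) \<in> E \<Longrightarrow> w a b + p b \<le> p a"
    proof (rule ex_bounded_potential[where A = A and R = "\<lambda>a a'. (a, ?m a') \<in> E" and w = w])
      show "w a a = 0" if "a \<in> A" for a
        using loop[OF that] by (simp add: w_def)
      show "w a a' \<le> 1" for a a'
        by (simp add: w_def wt_def)
    qed (use fin cyc mE in blast)+
    \<comment> \<open>An object receives the negated potential of its owner in \<open>M\<close>,
      recovered by \<open>inv_into\<close>, so the two values on each edge of \<open>M\<close>
      cancel.\<close>
    define \<alpha> where
      "\<alpha> u = (if u \<in> A then real_of_int (p u) else - real_of_int (p (inv_into A ?m u)))" for u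
    have \<alpha>A: "\<alpha> a = real_of_int (p a)" if "a \<in> A" for a
      using that by (simp add: \<alpha>_def)
    have \<alpha>B: "\<alpha> (?m a) = - real_of_int (p a)" if "a \<in> A" for a
      using that bij disj by (auto simp: \<alpha>_def bij_betw_def inv_into_f_f)
    have surj: "\<exists>a\<in>A. b = ?m a" if "b \<in> B" for b
      using bij that by (auto simp: bij_betw_def)
    have sum: "(\<Sum>u\<in>A \<union> B. \<alpha> u) = 0"
      unfolding sum_bipartite_eq[OF bip PM] by (simp add: \<alpha>A \<alpha>B)
    have "LP2_feasible E pref M \<alpha>"
      unfolding LP2_feasible_def
    proof safe
      fix a b assume ab: "(a, b) \<in> E"
      then have "a \<in> A" "b \<in> B"
        using EAB by auto
      then obtain a' where a': "a' \<in> A" "b = ?m a'"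
        using surj by blast
      \<comment> \<open>With \<open>a'\<close> the owner of \<open>b\<close>, the dual constraint on
        \<open>(a, b)\<close> is exactly the potential inequality between \<open>a\<close> and
        \<open>a'\<close>.\<close>
      have "real_of_int (w a a' + p a') \<le> real_of_int (p a)"
        using step[OF \<open>a \<in> A\<close> a'(1)] ab a'(2) by simp
      then show "?w a b \<le> \<alpha> a + \<alpha> b"
        using \<open>a \<in> A\<close> a' by (simp add: \<alpha>A \<alpha>B w)
    qed
    \<comment> \<open>Optimality: the edges of \<open>M\<close> have weight 0, so weak duality along
      \<open>M\<close> bounds every feasible objective below by 0, the value attained by
      \<alpha>.\<close>
    moreover have "0 \<le> (\<Sum>u\<in>A \<union> B. z u)" if "LP2_feasible E pref M z" for z
      using LP2_weak_duality[OF bip PM that] loop by simp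
    ultimately have "LP2_optimal A B E pref M \<alpha>"
      by (simp add: LP2_optimal_def sum)
    moreover have "\<forall>a\<in>A. \<alpha> a \<in> real_of_int ` {0..int n - 1}"
      using p assms(2) by (simp add: \<alpha>A)
    moreover have "\<forall>b\<in>B. \<alpha> b \<in> real_of_int ` {- (int n - 1)..0}"
    proof
      fix b assume "b \<in> B"
      then obtain a where a: "a \<in> A" "b = ?m a"
        using surj by blast
      then have "\<alpha> b = real_of_int (- p a)" "- p a \<in> {- (int n - 1)..0}"
        using p[OF a(1)] assms(2) by (auto simp: \<alpha>B)
      then show "\<alpha> b \<in> real_of_int ` {- (int n - 1)..0}"
        by blast
    qed
    ultimately show "\<exists>\<alpha> :: 'v \<Rightarrow> real.
       LP2_optimal A B E pref M \<alpha> \<and>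
       (\<forall>a\<in>A. \<alpha> a \<in> real_of_int ` {0..int n - 1}) \<and>
       (\<forall>b\<in>B. \<alpha> b \<in> real_of_int ` {- (int n - 1)..0}) \<and>
       (\<Sum>u\<in>A \<union> B. \<alpha> u) = 0"
      using sum by blast
  next
    assume "\<exists>\<alpha> :: 'v \<Rightarrow> real.
       LP2_optimal A B E pref M \<alpha> \<and>
       (\<forall>a\<in>A. \<alpha> a \<in> real_of_int ` {0..int n - 1}) \<and>
       (\<forall>b\<in>B. \<alpha> b \<in> real_of_int ` {- (int n - 1)..0}) \<and>
       (\<Sum>u\<in>A \<union> B. \<alpha> u) = 0"
    then obtain \<alpha> where "LP2_feasible E pref M \<alpha>" "(\<Sum>u\<in>A \<union> B. \<alpha> u) = 0"
      unfolding LP2_optimal_def by blast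
    then have "(\<Sum>a\<in>A. ?w a (partner N a)) \<le> 0" if "perfect_matching A B E N" for N
      using LP2_weak_duality[OF bip that] by metis
    then have "0 \<le> real_of_int (vote_diff A pref M N)" if "perfect_matching A B E N" for N
      using diff that by simp
    then show "popular_assignment A B E pref M"
      using PM by (simp add: popular_assignment_def)
  qed
qed

end
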